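(* For any odd prime $p$ and any positive integer $r$, $$\frac{1}{p^r}\sum_{k=0}^{(p^r-1)/2}(4k+1)\frac{(\frac12)_k^4}{(1)_k^4}\equiv \frac{1}{p}\sum_{k=0}^{(p-1)/2}(4k+1)\frac{(\frac12)_k^4}{(1)_k^4}\pmod{p^4}.$$
   Context: $(x)_k=x(x+1)\cdots(x+k-1)$ is the Pochhammer symbol, with $(x)_0=1$. A congruence $a\equiv b\pmod{p^m}$ between rational numbers means that $(a-b)/p^m$ is a rational number whose denominator is not divisible by $p$. *)

theory Defs
  imports Complex_Main "HOL-Computational_Algebra.Primes"
begin

definition rat_cong :: "rat \<Rightarrow> rat \<Rightarrow> int \<Rightarrow> nat \<Rightarrow> bool" where
  "rat_cong a b p m \<longleftrightarrow>
     (\<exists>x y::int. y \<noteq> 0 \<and> \<not> p dvd y \<and> (a - b) / of_int p ^ m = of_int x / of_int y)"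

definition S :: "nat \<Rightarrow> rat" where
  "S n = (1 / of_nat n) *
     (\<Sum>k = 0..(n - 1) div 2. (4 * of_nat k + 1) *
        (pochhammer (1/2 :: rat) k) ^ 4 / (pochhammer (1 :: rat) k) ^ 4)"

end

theory Submission
  imports Defs
begin

text \<open>
  Put \<open>c\<^sub>k = (1/2)\<^sub>k / k!\<close> and \<open>n = 2 N + 1\<close>. A telescoping (WZ) argument gives
  \<open>\<Sum>k\<le>N. (4 k + 1) c\<^sub>k\<^sup>4 = 2 n\<^sup>2 c\<^sub>N\<^sup>2 (\<Sum>i\<le>N. c\<^sub>i c\<^bsub>n-i\<^esub> / (n - 2 i))\<close>.
  Both \<open>2 c\<^sub>N\<^sup>2 c\<^sub>n\<close> and \<open>c\<^sub>i c\<^bsub>n-i\<^esub> / c\<^sub>n\<close> are products of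
  factors depending only on the ratios \<open>n / t\<close> with \<open>0 < t < n\<close>, and so \<open>S n\<close> is an
  expression in these ratios. For \<open>n = p q\<close> with \<open>q\<close> a power of \<open>p\<close>, the ratio \<open>n / t\<close> is
  divisible by \<open>p\<^sup>2\<close> unless \<open>q\<close> divides \<open>t\<close>; if \<open>t = q t'\<close>, it equals the ratio \<open>p / t'\<close>
  that occurs in \<open>S p\<close>. The other ratios enter either through \<open>1 - (n / t)\<^sup>2\<close>, or as a product of
  two of them, or in a term that already carries a factor \<open>p\<^sup>2\<close>, so they do not matter modulo \<open>p\<^sup>4\<close>.
\<close>

section \<open>An exact formula for the sum\<close>

definition c :: "nat \<Rightarrow> rat" where
  "c k = pochhammer (1/2) k / pochhammer 1 k"

lemma c_0 [simp]: "c 0 = 1"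
  by (simp add: c_def)

lemma c_Suc: "c (Suc k) = c k * (2 * of_nat k + 1) / (2 * of_nat k + 2)"
proof -
  have "(1 + of_nat k :: rat) \<noteq> 0" by (metis of_nat_Suc of_nat_neq_0)
  moreover have "pochhammer (1::rat) k \<noteq> 0" by (simp add: pochhammer_fact [symmetric])
  ultimately show ?thesis
    by (simp add: c_def pochhammer_Suc divide_simps) (simp add: algebra_simps)
qed

text \<open>
  The summation index of the header is \<open>i = N - s\<close> here; with \<open>s\<close> the two summands in
  \<open>wz_step\<close> that belong to \<open>N\<close> and \<open>N - 1\<close> are aligned.
\<close>

definition G :: "nat \<Rightarrow> nat \<Rightarrow> rat" where
  "G N s = c (N - s) * c (N + s + 1) / (2 * of_nat s + 1)"

text \<open>The right-hand side telescopes in \<open>s\<close>, while the left-hand side compares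
  the inner sums for \<open>N\<close> and \<open>N - 1\<close>. With \<open>N = s + Suc d\<close>,
  every product of two values of \<open>c\<close> here is a rational multiple of
  \<open>c d * c (N + s)\<close>, which leaves a polynomial identity.\<close>

lemma wz_step:
  assumes "s < N"
  shows "2 * (2 * of_nat N + 1)^2 * G N s - 8 * (of_nat N)^2 * G (N - 1) s
       = (4 * of_nat N + 1) * (c (N - s) * c (N + s) - c (N - Suc s) * c (N + Suc s))"
proof -
  obtain d where N: "N = s + Suc d" using assms less_imp_Suc_add by auto
  define x y :: rat where "x = of_nat s" and "y = of_nat d"
  define A B where "A = c d" and "B = c (N + s)"
  have nn: "x \<ge> 0" "y \<ge> 0" by (auto simp: x_def y_def)
  have n: "of_nat N = x + y + 1" by (simp add: N x_def y_def)
  have e: "N - s = Suc d" "N - Suc s = d" "N - 1 - s = d" "N + s + 1 = Suc (N + s)"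
    "N - 1 + s + 1 = N + s" using N by auto
  have c1: "c (Suc d) = A * (2 * y + 1) / (2 * y + 2)" by (simp add: c_Suc A_def y_def)
  have c2: "c (Suc (N + s)) = B * (4 * x + 2 * y + 3) / (4 * x + 2 * y + 4)"
    by (simp add: c_Suc B_def n x_def [symmetric] algebra_simps)
  have nz: "2 * y + 2 \<noteq> 0" "4 * x + 2 * y + 4 \<noteq> 0" "2 * x + 1 \<noteq> 0" using nn by linarith+
  have "2 * (2 * (x + y + 1) + 1)^2 *
          ((A * (2 * y + 1) / (2 * y + 2)) * (B * (4 * x + 2 * y + 3) / (4 * x + 2 * y + 4)) / (2 * x + 1))
        - 8 * (x + y + 1)^2 * (A * B / (2 * x + 1))
      = (4 * (x + y + 1) + 1) * (A * (2 * y + 1) / (2 * y + 2) * B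
          - A * (B * (4 * x + 2 * y + 3) / (4 * x + 2 * y + 4)))"
    using nz by (simp add: divide_simps) algebra
  then show ?thesis
    unfolding G_def e c1 c2 n by (simp add: A_def B_def e x_def c2 [unfolded B_def x_def])
qed

text \<open>Induction on the upper bound. From 2 N c_N = (2 N - 1) c_{N-1}, the outer factor 2 (2 N
  - 1)^2 c_{N-1}^2 belonging to N - 1 equals 8 N^2 c_N^2, the coefficient prepared in
  \<open>wz_step\<close> times c_N^2. The increment is then c_N^2 times a telescoping sum plus one
  boundary term.\<close>

lemma wz_sum:
  "(\<Sum>k=0..N. (4 * of_nat k + 1) * c k ^ 4) = 2 * (2 * of_nat N + 1)^2 * c N ^ 2 * (\<Sum>s=0..N. G N s)"
proof (induction N)
  case 0
  show ?case by (simp add: G_def c_Suc)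
next
  case (Suc M)
  define N where "N = Suc M"
  define x :: rat where "x = of_nat N"
  have x: "x \<ge> 0" by (simp add: x_def)
  have cM: "(2 * of_nat M + 1)^2 * c M ^ 2 = 4 * x^2 * c N ^ 2"
  proof -
    have "2 * x * c N = (2 * of_nat M + 1) * c M"
      using of_nat_neq_0 [of M, where 'a = rat]
      by (simp add: N_def c_Suc x_def field_simps)
    then have "(2 * x * c N)^2 = ((2 * of_nat M + 1) * c M)^2" by simp
    then show ?thesis by (simp add: power_mult_distrib)
  qed
  have tel: "2 * (2 * x + 1)^2 * (\<Sum>s<N. G N s) - 8 * x^2 * (\<Sum>s<N. G M s)
      = (4 * x + 1) * (c N * c N - c (2 * N))"
  proof -
    have "2 * (2 * x + 1)^2 * (\<Sum>s<N. G N s) - 8 * x^2 * (\<Sum>s<N. G M s)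
       = (\<Sum>s<N. 2 * (2 * x + 1)^2 * G N s - 8 * x^2 * G M s)"
      by (simp add: sum_distrib_left sum_subtractf)
    also have "\<dots> = (\<Sum>s<N. (4 * x + 1) *
        (c (N - s) * c (N + s) - c (N - Suc s) * c (N + Suc s)))"
      using wz_step [of _ N] by (intro sum.cong) (auto simp: x_def N_def)
    also have "\<dots> = (4 * x + 1) * (\<Sum>s<N.
        (c (N - s) * c (N + s) - c (N - Suc s) * c (N + Suc s)))"
      by (simp add: sum_distrib_left)
    also have "\<dots> = (4 * x + 1) * (c N * c N - c (2 * N))"
      by (subst sum_lessThan_telescope') (simp add: mult_2)
    finally show ?thesis .
  qed
  \<comment> \<open>The term s = N has no partner in the sum for \<open>M\<close>; it cancels
    exactly the \<open>c (2 * N)\<close> left over by the telescoping.\<close>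
  have last: "2 * (2 * x + 1)^2 * G N N = (4 * x + 1) * c (2 * N)"
  proof -
    have "2 * x + 1 \<noteq> 0" "4 * x + 2 \<noteq> 0" using x by linarith+
    moreover have "G N N = c (2 * N) * (4 * x + 1) / (4 * x + 2) / (2 * x + 1)"
      by (simp add: G_def c_Suc x_def flip: mult_2)
    ultimately show ?thesis by (simp add: divide_simps) algebra
  qed
  have I: "{0..M} = {..<N}" "{0..N} = insert N {..<N}" by (auto simp: N_def)
  have s: "(\<Sum>s=0..N. G N s) = G N N + (\<Sum>s<N. G N s)" unfolding I by simp
  have "(\<Sum>k=0..N. (4 * of_nat k + 1) * c k ^ 4)
     = (\<Sum>k=0..M. (4 * of_nat k + 1) * c k ^ 4) + (4 * x + 1) * c N ^ 4"
    by (simp add: N_def x_def)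
  also have "(\<Sum>k=0..M. (4 * of_nat k + 1) * c k ^ 4) = c N ^ 2 * (8 * x^2 * (\<Sum>s<N. G M s))"
    unfolding Suc.IH using cM by (simp add: I)
  also have "\<dots> + (4 * x + 1) * c N ^ 4
      = c N ^ 2 * (2 * (2 * x + 1)^2 * (G N N + (\<Sum>s<N. G N s)))"
    using tel last by algebra
  finally show ?case unfolding N_def [symmetric] s by (simp add: x_def algebra_simps)
qed

section \<open>Products of \<open>c\<close> at complementary indices\<close>

definition u :: "nat \<Rightarrow> nat \<Rightarrow> rat" where
  "u n i = - (\<Prod>t=1..<i. (1 - of_nat n / of_nat t)^2)
             * (\<Prod>t=1..<2*i. inverse (1 - 2 * of_nat n / of_nat t))"

text \<open>With c_k = binom(2k,k) / 4^k, the quotient c_i c_{n-i} / c_n is built from the falling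
  factorials of n (squared) and of 2n. Dividing each factor n - t or 2n - t by -t produces
  \<open>u\<close>; its minus sign comes from the odd number 2i - 1 of factors 2n - t. The proof
  below is by induction on \<open>i\<close>.\<close>

lemma c_mult_c_diff:
  assumes "1 \<le> i" "i \<le> n"
  shows "c i * c (n - i) = c n * (of_nat n / of_nat i) * u n i"
  using assms
proof (induction i rule: dec_induct)
  case base
  then obtain m where n: "n = Suc m" by (cases n) auto
  have "2 * (of_nat m :: rat) + 1 \<noteq> 0" "2 * (of_nat m :: rat) + 2 \<noteq> 0"
    using of_nat_0_le_iff [of m, where 'a = rat] by linarith+
  moreover have "{Suc 0..<2} = {Suc 0}" by auto
  ultimately show ?case
    by (simp add: n u_def c_Suc [of 0, simplified] c_Suc divide_simps) (simp add: algebra_simps)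
next
  case (step i)
  then obtain d where n: "n = i + Suc d" using less_imp_Suc_add by force
  define x y :: rat where "x = of_nat i" and "y = of_nat d"
  have xy: "x > 0" "y \<ge> 0" "of_nat n = x + y + 1" using step by (auto simp: x_def y_def n)
  define U where "U = u n i"
  have nz: "x \<noteq> 0" "2 * x \<noteq> 0" "2 * x + 1 \<noteq> 0" "x + 1 \<noteq> 0" "2 * x + 2 \<noteq> 0" "2 * y + 2 \<noteq> 0" "2 * y + 1 \<noteq> 0"
    "y + 1 \<noteq> 0" using xy by linarith+
  \<comment> \<open>The new factors sit at t = i (squared) and at t = 2i, 2i + 1 (inverted). The one
    at 2i cancels one of the two copies at i.\<close>
  have uS: "u n (Suc i) = U * (1 - (x + y + 1) / x)^2
       * inverse (1 - 2 * (x + y + 1) / (2 * x)) * inverse (1 - 2 * (x + y + 1) / (2 * x + 1))"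
    using step(1) by (simp add: u_def U_def xy x_def [symmetric] mult_ac add_ac)
  have f: "(1 - (x + y + 1) / x) = - ((y + 1) / x)" "(1 - 2 * (x + y + 1) / (2 * x)) = - ((y + 1) / x)"
    "(1 - 2 * (x + y + 1) / (2 * x + 1)) = - ((2 * y + 1) / (2 * x + 1))"
    using nz by (auto simp: divide_simps)
  have uS': "u n (Suc i) = U * ((y + 1) / x) * ((2 * x + 1) / (2 * y + 1))"
    unfolding uS f using nz by (simp add: power2_eq_square)
  have IH: "c i * (c d * (2 * y + 1) / (2 * y + 2)) = c n * ((x + y + 1) / x) * U"
    using step n by (simp add: U_def c_Suc xy(3) [symmetric]) (simp add: x_def y_def)
  have IH': "c i * c d = c n * ((x + y + 1) / x) * U * (2 * y + 2) / (2 * y + 1)"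
    unfolding IH [symmetric] using nz by simp
  have "c (Suc i) * c (n - Suc i) = (c i * c d) * ((2 * x + 1) / (2 * x + 2))"
    by (simp add: n c_Suc x_def)
  also have "\<dots> = c n * ((x + y + 1) / (x + 1)) * u n (Suc i)"
    unfolding IH' uS' using nz by (simp add: divide_simps) (simp add: algebra_simps)
  finally show ?case by (simp add: xy(3) x_def add_ac)
qed

section \<open>The common factor as a product over \<open>t < n\<close>\<close>

definition dfac :: "nat \<Rightarrow> nat \<Rightarrow> rat" where
  "dfac n t = (if even t then 1 - (of_nat n / of_nat t)^2 else inverse (1 - (of_nat n / of_nat t)^2))"

lemma prod_pairs:
  fixes f :: "nat \<Rightarrow> rat"
  shows "(\<Prod>t=1..<2*N+1. f t) = (\<Prod>a=1..N. f (2 * a - 1)) * (\<Prod>a=1..N. f (2 * a))"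
  by (induction N) (simp_all add: mult_ac)

lemma c_prod: "c N = (\<Prod>a=1..N. 2 * of_nat a - 1) / (\<Prod>a=1..N. 2 * of_nat a)"
  by (induction N) (simp_all add: c_Suc algebra_simps)

lemma c_add:
  "c (N + k) * (\<Prod>a=1..k. 2 * of_nat N + 2 * of_nat a)
     = c N * (\<Prod>a=0..<k. 2 * of_nat N + 1 + 2 * of_nat a)"
proof (induction k)
  case (Suc k)
  have "2 * (of_nat N + of_nat k) + (2::rat) \<noteq> 0"
    by (intro order.strict_implies_not_eq [THEN not_sym] add_nonneg_pos) auto
  then have "c (N + Suc k) * (2 * of_nat N + 2 * of_nat (Suc k))
      = c (N + k) * (2 * of_nat N + 1 + 2 * of_nat k)"
    by (simp add: c_Suc divide_simps) (simp add: algebra_simps)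
  with Suc.IH show ?case by simp algebra
qed simp

lemma prod_signed_quotient:
  fixes f g h :: "nat \<Rightarrow> rat"
  shows "(\<Prod>a=1..N. (-1) * (f a * g a / (h a * h a))) =
    (-1) ^ N * ((\<Prod>a=1..N. f a) * (\<Prod>a=1..N. g a) / ((\<Prod>a=1..N. h a) * (\<Prod>a=1..N. h a)))"
  by (induction N) (simp_all add: mult_ac)

text \<open>Each 1 - (n/b)^2 splits into -(n - b)(n + b) / b^2. Since n is odd, n - b runs through
  the odd numbers below n when b runs through the even ones, and conversely, so these products
  reduce to \<open>O1\<close> and \<open>E\<close>. The products \<open>P\<close> and
  \<open>Q\<close> of the n + b are those in c_n / c_N. Pairing n - b with n + b makes n/b enter
  only through its square.\<close>

lemma two_c_square_c_eq:
  assumes n: "n = 2 * N + 1"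
  shows "2 * c N ^ 2 * c n = (\<Prod>t=1..<n. dfac n t)"
proof -
  define O1 E :: rat where "O1 = (\<Prod>a=1..N. 2 * of_nat a - 1)" and "E = (\<Prod>a=1..N. 2 * of_nat a)"
  define P Q :: rat where "P = (\<Prod>a=1..N. of_nat n + 2 * of_nat a)"
    and "Q = (\<Prod>a=1..N. of_nat n + (2 * of_nat a - 1))"
  have pos: "2 * of_nat a - 1 > (0::rat)" if "a \<ge> 1" for a
  proof -
    have "(of_nat a :: rat) \<ge> 1" using that by simp
    then show ?thesis by linarith
  qed
  have "O1 > 0" "E > 0" "P > 0" "Q > 0"
    unfolding O1_def E_def P_def Q_def using pos
    by (auto intro!: prod_pos add_nonneg_pos)
  then have nz: "O1 \<noteq> 0" "E \<noteq> 0" "P \<noteq> 0" "Q \<noteq> 0" by auto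
  \<comment> \<open>Reversing the order of the factors: n - 2a = 2 (N + 1 - a) - 1, and below n -
    (2a - 1) = 2 (N + 1 - a).\<close>
  have rO: "(\<Prod>a=1..N. of_nat n - 2 * of_nat a) = O1" unfolding O1_def
    by (rule prod.reindex_bij_witness [where i = "\<lambda>a. N + 1 - a" and j = "\<lambda>a. N + 1 - a"])
       (auto simp: n of_nat_diff)
  have rE: "(\<Prod>a=1..N. of_nat n - (2 * of_nat a - 1)) = E" unfolding E_def
    by (rule prod.reindex_bij_witness [where i = "\<lambda>a. N + 1 - a" and j = "\<lambda>a. N + 1 - a"])
       (auto simp: n of_nat_diff)
  have factor: "1 - (of_nat n / b)^2 = (-1) * ((of_nat n - b) * (of_nat n + b) / (b * b))"
    if "b \<noteq> 0" for b :: rat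
    using that by (simp add: divide_simps power2_eq_square) (simp add: algebra_simps)
  have ev: "(\<Prod>a=1..N. dfac n (2 * a)) = (-1)^N * (O1 * P / (E * E))"
  proof -
    have "(\<Prod>a=1..N. dfac n (2 * a))
       = (\<Prod>a=1..N. (-1) * ((of_nat n - 2 * of_nat a) * (of_nat n + 2 * of_nat a)
            / (2 * of_nat a * (2 * of_nat a))))"
      by (intro prod.cong refl, subst factor [symmetric]) (auto simp: dfac_def)
    then show ?thesis
      by (simp only: prod_signed_quotient rO P_def [symmetric] E_def [symmetric])
  qed
  have od: "(\<Prod>a=1..N. dfac n (2 * a - 1)) = (-1)^N * (O1 * O1 / (E * Q))"
  proof -
    have "(\<Prod>a=1..N. dfac n (2 * a - 1))
       = (\<Prod>a=1..N. inverse ((-1) * ((of_nat n - (2 * of_nat a - 1)) * (of_nat n + (2 * of_nat a - 1))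
            / ((2 * of_nat a - 1) * (2 * of_nat a - 1)))))"
    proof (intro prod.cong refl, subst factor [symmetric])
      fix a assume "a \<in> {1..N}"
      then have a: "a \<ge> 1" by simp
      show "2 * of_nat a - 1 \<noteq> (0::rat)" using pos [OF a] by simp
      have "of_nat (2 * a - 1) = (2 * of_nat a - 1 :: rat)" using a by (simp add: of_nat_diff)
      then show "dfac n (2 * a - 1) = inverse (1 - (of_nat n / (2 * of_nat a - 1))^2)"
        using a by (simp add: dfac_def)
    qed
    also have "\<dots> = inverse ((\<Prod>a=1..N. (-1) * ((of_nat n - (2 * of_nat a - 1)) * (of_nat n + (2 * of_nat a - 1))
            / ((2 * of_nat a - 1) * (2 * of_nat a - 1)))))"
      by (rule prod_inversef [unfolded o_def])
    also have "\<dots> = inverse ((-1)^N * (E * Q / (O1 * O1)))"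
      by (simp only: prod_signed_quotient rE Q_def [symmetric] O1_def [symmetric])
    also have "\<dots> = (-1)^N * (O1 * O1 / (E * Q))"
      by (simp only: inverse_mult_distrib power_inverse [symmetric]) simp
    finally show ?thesis .
  qed
  \<comment> \<open>Going from c_N to c_n takes N + 1 steps of the recurrence. The last denominator
    is 2n and the first numerator is n, so that only a factor 2 survives besides \<open>P\<close>
    and \<open>Q\<close>.\<close>
  have cn: "2 * c n * Q = c N * P"
  proof -
    have "c (N + Suc N) * (\<Prod>a=1..Suc N. 2 * of_nat N + 2 * of_nat a)
       = c N * (\<Prod>a=0..<Suc N. 2 * of_nat N + 1 + 2 * of_nat a)" by (rule c_add)
    moreover have "(\<Prod>a=1..Suc N. 2 * of_nat N + 2 * of_nat a :: rat) = Q * (2 * of_nat n)"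
      by (simp add: Q_def n)
    moreover have "(\<Prod>a=0..<Suc N. 2 * of_nat N + 1 + 2 * of_nat a :: rat) = of_nat n * P"
    proof -
      have "{1..<Suc N} = {1..N}" by auto
      then show ?thesis by (subst prod.atLeast_Suc_lessThan) (simp_all add: P_def n add.commute)
    qed
    moreover have "N + Suc N = n" by (simp add: n)
    ultimately have "c n * (Q * (2 * of_nat n)) = c N * (of_nat n * P)" by (simp only:)
    then have "of_nat n * (2 * c n * Q) = of_nat n * (c N * P)" by (simp only: mult_ac)
    moreover have "of_nat n \<noteq> (0::rat)" by (simp add: n)
    ultimately show ?thesis by simp
  qed
  have cN: "c N = O1 / E" by (simp add: c_prod O1_def E_def)
  have cn': "c n = c N * P / (2 * Q)" using cn nz by (simp add: field_simps)
  have sgn: "(-1)^N * (-1)^N = (1::rat)" by (simp flip: power_mult_distrib)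
  have "(\<Prod>t=1..<n. dfac n t) = ((-1)^N * (-1)^N) * ((O1 * O1 / (E * Q)) * (O1 * P / (E * E)))"
    using prod_pairs [of "dfac n" N] 
    unfolding n [symmetric] ev od by (simp only: mult_ac)
  also have "\<dots> = 2 * c N ^ 2 * c n"
    unfolding cn' unfolding cN sgn using nz by (simp add: divide_simps power2_eq_square)
  finally show ?thesis by simp
qed

text \<open>In \<open>wz_sum\<close> one factor n cancels the 1/n of \<open>S\<close>. The summand i
  = 0 is c_n / n and yields the 1; the others contain c_n by \<open>c_mult_c_diff\<close>, and the
  remaining n is paired with 1 / (n - 2i).\<close>

lemma S_eq:
  assumes n: "n = 2 * N + 1"
  shows "S n = (\<Prod>t=1..<n. dfac n t) *
    (1 + (\<Sum>i=1..N. (of_nat n / of_nat i) * (of_nat n / of_nat (n - 2 * i)) * u n i))"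
proof -
  have n0: "of_nat n \<noteq> (0::rat)" by (simp add: n)
  have "S n = (1 / of_nat n) * (\<Sum>k=0..N. (4 * of_nat k + 1) * c k ^ 4)"
    by (simp add: S_def c_def n power_divide)
  also have "\<dots> = (1 / of_nat n) * (2 * (of_nat n)^2 * c N ^ 2 * (\<Sum>s=0..N. G N s))"
    unfolding wz_sum by (simp add: n)
  also have "\<dots> = 2 * of_nat n * c N ^ 2 * (\<Sum>s=0..N. G N s)"
    using n0 by (simp add: power2_eq_square)
  \<comment> \<open>For i = N - s one has N + s + 1 = n - i and 2 s + 1 = n - 2 i.\<close>
  also have "(\<Sum>s=0..N. G N s) = (\<Sum>i=0..N. c i * c (n - i) / of_nat (n - 2 * i))"
    by (rule sum.reindex_bij_witness [where i = "\<lambda>s. N - s" and j = "\<lambda>s. N - s"])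
       (auto simp: G_def n of_nat_diff algebra_simps)
  also have "\<dots> = c n / of_nat n + (\<Sum>i=1..N. c i * c (n - i) / of_nat (n - 2 * i))"
    by (simp add: sum.atLeast_Suc_atMost [of 0 N])
  also have "(\<Sum>i=1..N. c i * c (n - i) / of_nat (n - 2 * i))
     = (\<Sum>i=1..N. c n * (of_nat n / of_nat i) * u n i / of_nat (n - 2 * i))"
    by (intro sum.cong refl arg_cong2 [where f = "(/)"] c_mult_c_diff) (auto simp: n)
  also have "\<dots> = c n * (\<Sum>i=1..N. (of_nat n / of_nat i) * u n i / of_nat (n - 2 * i))"
    by (simp add: sum_distrib_left mult_ac)
  finally have "S n = 2 * c N ^ 2 * c n * (1 + of_nat n *
      (\<Sum>i=1..N. (of_nat n / of_nat i) * u n i / of_nat (n - 2 * i)))"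
    using n0 by (simp add: distrib_left)
  then show ?thesis
    unfolding two_c_square_c_eq [OF n] by (simp add: sum_distrib_left mult_ac)
qed

section \<open>Congruences in the localization of the integers at a prime\<close>

definition zloc :: "nat \<Rightarrow> rat set" where
  "zloc p = {x. \<exists>a b::int. \<not> int p dvd b \<and> x = of_int a / of_int b}"

definition zcong :: "nat \<Rightarrow> nat \<Rightarrow> rat \<Rightarrow> rat \<Rightarrow> bool" where
  "zcong p m x y \<longleftrightarrow> (\<exists>z\<in>zloc p. x - y = of_nat p ^ m * z)"

context
  fixes p :: nat
  assumes p: "prime p"
begin

lemma zloc_of_int [simp, intro]: "of_int a \<in> zloc p"
proof -
  have "\<not> int p dvd 1" using p by (simp add: prime_nat_iff)
  moreover have "of_int a = (of_int a / of_int 1 :: rat)" by simp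
  ultimately show ?thesis unfolding zloc_def by blast
qed

lemma zloc_of_nat [simp, intro]: "of_nat a \<in> zloc p"
  using zloc_of_int [of "int a"] by simp

lemma zloc_0_1_2 [simp, intro]: "0 \<in> zloc p" "1 \<in> zloc p" "2 \<in> zloc p"
  using zloc_of_int [of 0] zloc_of_int [of 1] zloc_of_int [of 2] by simp_all

lemma zloc_mult [intro]: "x \<in> zloc p \<Longrightarrow> y \<in> zloc p \<Longrightarrow> x * y \<in> zloc p"
proof -
  assume "x \<in> zloc p" "y \<in> zloc p"
  then obtain a b a' b' :: int where
    *: "\<not> int p dvd b" "x = of_int a / of_int b" "\<not> int p dvd b'" "y = of_int a' / of_int b'"
    by (auto simp: zloc_def)
  have "\<not> int p dvd b * b'" using * p by (simp add: prime_dvd_mult_iff)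
  moreover have "x * y = of_int (a * a') / of_int (b * b')" using * by simp
  ultimately show ?thesis unfolding zloc_def by blast
qed

lemma zloc_add [intro]: "x \<in> zloc p \<Longrightarrow> y \<in> zloc p \<Longrightarrow> x + y \<in> zloc p"
proof -
  assume "x \<in> zloc p" "y \<in> zloc p"
  then obtain a b a' b' :: int where
    *: "\<not> int p dvd b" "x = of_int a / of_int b" "\<not> int p dvd b'" "y = of_int a' / of_int b'"
    by (auto simp: zloc_def)
  have "\<not> int p dvd b * b'" using * p by (simp add: prime_dvd_mult_iff)
  moreover have "b \<noteq> 0" "b' \<noteq> 0" using * by auto
  then have "x + y = of_int (a * b' + a' * b) / of_int (b * b')" using * by (simp add: field_simps)
  ultimately show ?thesis unfolding zloc_def by blast
qed

lemma zloc_uminus [intro]: "x \<in> zloc p \<Longrightarrow> - x \<in> zloc p"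
  using zloc_mult [OF zloc_of_int [of "-1"]] by simp

lemma zloc_diff [intro]: "x \<in> zloc p \<Longrightarrow> y \<in> zloc p \<Longrightarrow> x - y \<in> zloc p"
  using zloc_add [of x "- y"] zloc_uminus [of y] by simp

lemma zloc_power [intro]: "x \<in> zloc p \<Longrightarrow> x ^ k \<in> zloc p"
  by (induction k) auto

lemma zloc_prod: "(\<And>t. t \<in> A \<Longrightarrow> f t \<in> zloc p) \<Longrightarrow> prod f A \<in> zloc p"
  by (induction A rule: infinite_finite_induct) auto

lemma zloc_sum: "(\<And>t. t \<in> A \<Longrightarrow> f t \<in> zloc p) \<Longrightarrow> sum f A \<in> zloc p"
  by (induction A rule: infinite_finite_induct) auto

lemma zloc_inverse_of_nat: "\<not> p dvd w \<Longrightarrow> 1 / of_nat w \<in> zloc p"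
proof -
  assume "\<not> p dvd w"
  then have "\<not> int p dvd int w" by simp
  moreover have "1 / of_nat w = (of_int 1 / of_int (int w) :: rat)" by simp
  ultimately show ?thesis unfolding zloc_def by blast
qed

text \<open>For x = a/b the inverse is b / (b - p a), and b - p a is prime to p because b
  is.\<close>

lemma zloc_inverse_unit:
  assumes "x \<in> zloc p"
  shows "inverse (1 - of_nat p * x) \<in> zloc p"
proof -
  obtain a b :: int where *: "\<not> int p dvd b" "x = of_int a / of_int b"
    using assms by (auto simp: zloc_def)
  then have b: "b \<noteq> 0" by auto
  have "\<not> int p dvd b - int p * a" using *(1) by (metis dvd_add_left_iff dvd_triv_left diff_add_cancel)
  moreover have "inverse (1 - of_nat p * x) = of_int b / of_int (b - int p * a)"
  proof -
    have "of_int (b - int p * a) = of_int b * (1 - of_nat p * x)"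
      using b *(2) by (simp add: field_simps)
    then show ?thesis using b by (simp add: inverse_eq_divide)
  qed
  ultimately show ?thesis unfolding zloc_def by blast
qed

section \<open>Calculus of congruences\<close>

lemma zcong_refl [simp, intro]: "zcong p m x x"
  by (auto simp: zcong_def intro: bexI [of _ 0])

lemma zcong_trans: "zcong p m x y \<Longrightarrow> zcong p m y z \<Longrightarrow> zcong p m x z"
  unfolding zcong_def by (metis (no_types, lifting) add_diff_cancel_left' diff_add_cancel
      add_diff_eq distrib_left zloc_add)

lemma zcong_add: "zcong p m x y \<Longrightarrow> zcong p m x' y' \<Longrightarrow> zcong p m (x + x') (y + y')"
  unfolding zcong_def by (metis (no_types, lifting) add_diff_add distrib_left zloc_add)

lemma zcong_mult:
  assumes "zcong p m x y" "zcong p m x' y'" "x' \<in> zloc p" "y \<in> zloc p"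
  shows "zcong p m (x * x') (y * y')"
proof -
  obtain z z' where *: "z \<in> zloc p" "x - y = of_nat p ^ m * z"
    "z' \<in> zloc p" "x' - y' = of_nat p ^ m * z'" using assms by (auto simp: zcong_def)
  have "x * x' - y * y' = (x - y) * x' + y * (x' - y')" by algebra
  also have "\<dots> = of_nat p ^ m * (z * x' + y * z')" unfolding * by algebra
  finally show ?thesis unfolding zcong_def using * assms by blast
qed

text \<open>An explicit factor p^k raises the modulus. This lifts the congruence for
  \<open>u\<close>, available only modulo p^2, to p^4.\<close>

lemma zcong_mult_power:
  "zcong p m x y \<Longrightarrow> z \<in> zloc p \<Longrightarrow> zcong p (m + k) (of_nat p ^ k * z * x) (of_nat p ^ k * z * y)"
  unfolding zcong_def
proof (elim bexE)
  fix w assume "z \<in> zloc p" "w \<in> zloc p" "x - y = of_nat p ^ m * w"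
  then show "\<exists>w\<in>zloc p. of_nat p ^ k * z * x - of_nat p ^ k * z * y = of_nat p ^ (m + k) * w"
    by (intro bexI [of _ "z * w"]) (auto simp: power_add algebra_simps simp flip: right_diff_distrib)
qed

lemma zcong_sum:
  "(\<And>t. t \<in> A \<Longrightarrow> zcong p m (f t) (g t)) \<Longrightarrow> zcong p m (sum f A) (sum g A)"
  by (induction A rule: infinite_finite_induct) (auto intro: zcong_add)

lemma zcong_prod:
  assumes "\<And>t. t \<in> A \<Longrightarrow> zcong p m (f t) (g t)" "\<And>t. t \<in> A \<Longrightarrow> f t \<in> zloc p"
    "\<And>t. t \<in> A \<Longrightarrow> g t \<in> zloc p"
  shows "zcong p m (prod f A) (prod g A)"
  using assms
  by (induction A rule: infinite_finite_induct) (auto intro: zcong_mult zloc_prod)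

text \<open>Factors at indices prime to being multiples of q are replaced by 1; the surviving
  indices are q t with 0 < t < k.\<close>

lemma zcong_prod_multiples:
  fixes q k m :: nat
  assumes "q > 0"
    and unit: "\<And>t. 0 < t \<Longrightarrow> t < q * k \<Longrightarrow> \<not> q dvd t \<Longrightarrow> zcong p m (f t) 1"
    and f: "\<And>t. 0 < t \<Longrightarrow> t < q * k \<Longrightarrow> f t \<in> zloc p"
    and fg: "\<And>t. 0 < t \<Longrightarrow> t < k \<Longrightarrow> f (q * t) = g t"
  shows "zcong p m (prod f {1..<q*k}) (prod g {1..<k})"
proof -
  have "{t \<in> {1..<q*k}. q dvd t} = (*) q ` {1..<k}"
    using \<open>q > 0\<close> by (auto simp: Suc_le_eq dvd_def)
  then have "prod f {t \<in> {1..<q*k}. q dvd t} = (\<Prod>t=1..<k. f (q * t))"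
    using \<open>q > 0\<close> by (simp add: prod.reindex inj_on_def)
  also have "\<dots> = prod g {1..<k}" by (intro prod.cong) (auto simp: fg)
  finally have "prod f {t \<in> {1..<q*k}. q dvd t} = prod g {1..<k}" .
  moreover have "prod f {t \<in> {1..<q*k}. q dvd t} = (\<Prod>t\<in>{1..<q*k}. if q dvd t then f t else 1)"
    by (rule prod.inter_filter) simp
  moreover have "zcong p m (prod f {1..<q*k}) (\<Prod>t\<in>{1..<q*k}. if q dvd t then f t else 1)"
    by (intro zcong_prod) (auto intro: unit f)
  ultimately show ?thesis by simp
qed

text \<open>Additive counterpart of \<open>zcong_prod_multiples\<close>. The terms at multiples of q
  are matched only up to congruence, since \<open>u\<close> is not reproduced exactly.\<close>

lemma zcong_sum_multiples:
  fixes q k m :: nat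
  assumes "q > 0"
    and zero: "\<And>t. 0 < t \<Longrightarrow> t \<le> M \<Longrightarrow> \<not> q dvd t \<Longrightarrow> zcong p m (f t) 0"
    and fg: "\<And>t. 0 < t \<Longrightarrow> t \<le> k \<Longrightarrow> zcong p m (f (q * t)) (g t)"
    and k: "k = M div q"
  shows "zcong p m (sum f {1..M}) (sum g {1..k})"
proof -
  have "{t \<in> {1..M}. q dvd t} = (*) q ` {1..k}"
    using \<open>q > 0\<close> by (auto simp: k Suc_le_eq less_eq_div_iff_mult_less_eq mult.commute dvd_def)
  then have "(\<Sum>t\<in>{t \<in> {1..M}. q dvd t}. f t) = (\<Sum>t=1..k. f (q * t))"
    using \<open>q > 0\<close> by (simp add: sum.reindex inj_on_def)
  moreover have "(\<Sum>t\<in>{t \<in> {1..M}. q dvd t}. f t) = (\<Sum>t=1..M. if q dvd t then f t else 0)"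
    by (rule sum.inter_filter) simp
  moreover have "zcong p m (sum f {1..M}) (\<Sum>t=1..M. if q dvd t then f t else 0)"
    by (intro zcong_sum) (auto intro: zero)
  moreover have "zcong p m (\<Sum>t=1..k. f (q * t)) (sum g {1..k})"
    by (intro zcong_sum) (auto intro: fg)
  ultimately show ?thesis by (metis zcong_trans)
qed

section \<open>Comparison of the two sums\<close>

text \<open>Write t = p^j w with w prime to p. Then j < e, and the ratio is p^(e+1-j) / w with
  exponent at least 2.\<close>

lemma ratio_non_multiple:
  assumes "0 < t" "\<not> p ^ e dvd t"
  shows "\<exists>z\<in>zloc p. of_nat (p * p ^ e) / of_nat t = of_nat p ^ 2 * z"
proof -
  obtain j w where t: "t = p ^ j * w" and w: "\<not> p dvd w"
    using assms p by (metis multiplicity_decompose' not_prime_unit neq0_conv)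
  have "j < e" using assms t by (metis dvd_mult2 le_imp_power_dvd linorder_le_less_linear)
  then obtain d where e: "e = Suc (j + d)" using less_imp_Suc_add by blast
  have "of_nat p \<noteq> (0::rat)" using p by auto
  moreover have "of_nat w \<noteq> (0::rat)" using w by (metis dvd_0_right of_nat_eq_0_iff)
  ultimately have "of_nat (p * p ^ e) / of_nat t = (of_nat p ^ 2 * (of_nat p ^ d * (1 / of_nat w)) :: rat)"
    unfolding t e by (simp add: power_add power2_eq_square)
  moreover have "of_nat p ^ d * (1 / of_nat w) \<in> zloc p"
    using zloc_inverse_of_nat [OF w] by (intro zloc_mult zloc_power) auto
  ultimately show ?thesis by blast
qed

text \<open>If t = p^e t', then 0 < t' < p and the ratio is p / t' with t' prime to p; all other t
  carry even p^2.\<close>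

lemma ratio_multiple:
  assumes "0 < t" "t < p * p ^ e"
  shows "\<exists>z\<in>zloc p. of_nat (p * p ^ e) / of_nat t = of_nat p * z"
proof (cases "p ^ e dvd t")
  case True
  then obtain t' where t: "t = p ^ e * t'" by blast
  have t': "0 < t'" "t' < p" using assms t by (auto simp: mult.commute)
  have "of_nat (p * p ^ e) / of_nat t = (of_nat p * (1 / of_nat t') :: rat)"
    using p by (auto simp: t)
  moreover have "\<not> p dvd t'" using t' by (auto dest: dvd_imp_le)
  ultimately show ?thesis using zloc_inverse_of_nat by blast
next
  case False
  then obtain z where "z \<in> zloc p" "of_nat (p * p ^ e) / of_nat t = of_nat p ^ 2 * z"
    using ratio_non_multiple assms by blast
  then show ?thesis by (intro bexI [of _ "of_nat p * z"]) (auto simp: power2_eq_square)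
qed

lemma ratio_zloc: "0 < t \<Longrightarrow> t < p * p ^ e \<Longrightarrow> of_nat (p * p ^ e) / of_nat t \<in> zloc p"
  using ratio_multiple [of t e] zloc_mult zloc_of_nat by metis

section \<open>Integrality and congruences of the factors\<close>

lemma zcong_inverse_1:
  assumes "zcong p m x 1" "inverse x \<in> zloc p" "x \<noteq> 0"
  shows "zcong p m (inverse x) 1"
proof -
  obtain z where z: "z \<in> zloc p" "x - 1 = of_nat p ^ m * z" using assms by (auto simp: zcong_def)
  have "inverse x - 1 = - inverse x * (x - 1)" using \<open>x \<noteq> 0\<close> by (simp add: algebra_simps)
  also have "\<dots> = of_nat p ^ m * (- inverse x * z)" by (simp add: z)
  finally show ?thesis unfolding zcong_def using z assms by blast
qed

text \<open>Because \<open>inverse 0 = 0\<close>, \<open>zloc_inverse_unit\<close> does not rule out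
  a vanishing factor, whereas \<open>zcong_inverse_1\<close> requires a nonzero one.\<close>

lemma one_minus_neq_0:
  assumes "x \<in> zloc p"
  shows "1 - of_nat p * x \<noteq> 0"
proof
  assume "1 - of_nat p * x = 0"
  moreover obtain a b :: int where *: "\<not> int p dvd b" "x = of_int a / of_int b"
    using assms by (auto simp: zloc_def)
  moreover have "b \<noteq> 0" using * by auto
  ultimately have "of_int b = (of_int (int p * a) :: rat)" by (simp add: field_simps)
  then have "b = int p * a" by (simp only: of_int_eq_iff)
  with * show False by simp
qed

lemma dfac_zloc:
  assumes "0 < t" "t < p * p ^ e"
  shows "dfac (p * p ^ e) t \<in> zloc p"
    and "1 - (of_nat (p * p ^ e) / of_nat t)^2 \<noteq> (0::rat)"
proof -
  obtain z where z: "z \<in> zloc p" "of_nat (p * p ^ e) / of_nat t = of_nat p * z"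
    using ratio_multiple assms by blast
  have sq: "(of_nat p * z)^2 = of_nat p * (of_nat p * z^2)" by (simp add: power2_eq_square)
  have zl: "of_nat p * z^2 \<in> zloc p" using z by auto
  then show "dfac (p * p ^ e) t \<in> zloc p"
    unfolding dfac_def z sq using zloc_inverse_unit by auto
  show "1 - (of_nat (p * p ^ e) / of_nat t)^2 \<noteq> (0::rat)"
    unfolding z sq using one_minus_neq_0 zl by blast
qed

lemma dfac_cong:
  assumes "0 < t" "t < p * p ^ e" "\<not> p ^ e dvd t"
  shows "zcong p 4 (dfac (p * p ^ e) t) 1"
proof -
  obtain z where z: "z \<in> zloc p" "of_nat (p * p ^ e) / of_nat t = of_nat p ^ 2 * z"
    using ratio_non_multiple assms by blast
  have *: "zcong p 4 (1 - (of_nat (p * p ^ e) / of_nat t)^2) 1"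
    unfolding z zcong_def using z
    by (intro bexI [of _ "- (z^2)"]) (auto simp: power_mult_distrib simp flip: power_mult)
  show ?thesis
    using * dfac_zloc [OF assms(1,2)] unfolding dfac_def
    by (auto intro: zcong_inverse_1 split: if_splits)
qed

lemma u_factor_inverse:
  assumes "0 < t" "t < p * p ^ e"
  shows "inverse (1 - 2 * of_nat (p * p ^ e) / of_nat t) \<in> zloc p"
    and "1 - 2 * of_nat (p * p ^ e) / of_nat t \<noteq> (0::rat)"
proof -
  obtain z where z: "z \<in> zloc p" "of_nat (p * p ^ e) / of_nat t = of_nat p * z"
    using ratio_multiple assms by blast
  have m: "2 * of_nat (p * p ^ e) / of_nat t = of_nat p * (2 * z)" using z by simp
  have "2 * z \<in> zloc p" using z by auto
  then show "inverse (1 - 2 * of_nat (p * p ^ e) / of_nat t) \<in> zloc p"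
    "1 - 2 * of_nat (p * p ^ e) / of_nat t \<noteq> (0::rat)"
    unfolding m using zloc_inverse_unit one_minus_neq_0 by auto
qed

text \<open>Here the ratio n/t enters linearly, so only p^2 is gained, in contrast to
  \<open>dfac_cong\<close>.\<close>

lemma u_factor_cong:
  assumes "0 < t" "t < p * p ^ e" "\<not> p ^ e dvd t"
  shows "zcong p 2 ((1 - of_nat (p * p ^ e) / of_nat t)^2) 1"
    and "zcong p 2 (inverse (1 - 2 * of_nat (p * p ^ e) / of_nat t)) 1"
proof -
  obtain z where z: "z \<in> zloc p" "of_nat (p * p ^ e) / of_nat t = of_nat p ^ 2 * z"
    using ratio_non_multiple assms by blast
  have m: "2 * of_nat (p * p ^ e) / of_nat t = 2 * (of_nat p ^ 2 * z)" using z by simp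
  show "zcong p 2 ((1 - of_nat (p * p ^ e) / of_nat t)^2) 1"
    unfolding z zcong_def
  proof (intro bexI [of _ "of_nat p ^ 2 * z^2 - 2 * z"])
    show "(1 - of_nat p ^ 2 * z)^2 - 1 = of_nat p ^ 2 * (of_nat p ^ 2 * z^2 - 2 * z)"
      by (simp add: power2_eq_square algebra_simps)
    show "of_nat p ^ 2 * z^2 - 2 * z \<in> zloc p"
      using z by (intro zloc_diff zloc_mult zloc_power) auto
  qed
  have "zcong p 2 (1 - 2 * of_nat (p * p ^ e) / of_nat t) 1"
    unfolding m zcong_def using z
    by (intro bexI [of _ "- (2 * z)"]) auto
  then show "zcong p 2 (inverse (1 - 2 * of_nat (p * p ^ e) / of_nat t)) 1"
    using u_factor_inverse assms by (intro zcong_inverse_1)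
qed

lemma u_zloc:
  assumes "2 * i \<le> p * p ^ e"
  shows "u (p * p ^ e) i \<in> zloc p"
  unfolding u_def using assms
  by (intro zloc_mult zloc_uminus zloc_prod zloc_power zloc_diff zloc_0_1_2 ratio_zloc
      u_factor_inverse) auto

text \<open>In both products of \<open>u\<close> the indices not divisible by p^e drop out modulo
  p^2, and at p^e t the ratio is exactly p/t. The bound 2 i < p keeps all indices below
  p^(e+1).\<close>

lemma u_cong:
  assumes "0 < i" "2 * i < p"
  shows "zcong p 2 (u (p * p ^ e) (p ^ e * i)) (u p i)"
proof -
  have q: "p ^ e > 0" using p by (simp add: prime_gt_0_nat)
  have ineq: "t < p * p ^ e" if "t < p ^ e * k" "k \<le> p" for t k
  proof -
    have "p ^ e * k \<le> p * p ^ e" using that by simp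
    with that show ?thesis by linarith
  qed
  have cancel: "of_nat (p * p ^ e) / of_nat (p ^ e * t) = (of_nat p / of_nat t :: rat)"
    "2 * of_nat (p * p ^ e) / of_nat (p ^ e * t) = (2 * of_nat p / of_nat t :: rat)" for t
    using p by auto
  have "zcong p 2 (\<Prod>t=1..<p ^ e * i. (1 - of_nat (p * p ^ e) / of_nat t)^2)
                  (\<Prod>t=1..<i. (1 - of_nat p / of_nat t)^2)" (is "zcong _ _ ?A ?A'")
    by (rule zcong_prod_multiples [OF q])
       (use assms ineq [of _ i] cancel in \<open>auto intro!: u_factor_cong zloc_power zloc_diff ratio_zloc
          simp del: of_nat_mult\<close>)
  moreover have "zcong p 2 (\<Prod>t=1..<p ^ e * (2 * i). inverse (1 - 2 * of_nat (p * p ^ e) / of_nat t))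
                  (\<Prod>t=1..<2*i. inverse (1 - 2 * of_nat p / of_nat t))" (is "zcong _ _ ?B ?B'")
    by (rule zcong_prod_multiples [OF q])
       (use assms ineq [of _ "2 * i"] cancel in \<open>auto intro!: u_factor_cong
          u_factor_inverse simp del: of_nat_mult\<close>)
  moreover have "?B \<in> zloc p"
    using ineq [of _ "2 * i"] assms by (intro zloc_prod u_factor_inverse) auto
  moreover have "?A' \<in> zloc p"
    using ratio_zloc [of _ 0] assms by (intro zloc_prod zloc_power zloc_diff) auto
  ultimately have "zcong p 2 (?A * ?B) (?A' * ?B')" by (intro zcong_mult)
  then have "zcong p 2 (-1 * (?A * ?B)) (-1 * (?A' * ?B'))"
    by (intro zcong_mult [of 2 "-1" "-1"])
       (use \<open>?B \<in> zloc p\<close> zloc_of_int [of "-1"] ratio_zloc ineq [of _ i] assms in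
         \<open>auto intro!: zloc_mult zloc_prod zloc_power zloc_diff simp del: of_nat_mult\<close>)
  then show ?thesis by (simp add: u_def mult_ac)
qed

lemma S_prime_power_cong:
  assumes "odd p"
  shows "zcong p 4 (S (p * p ^ e)) (S p)"
proof -
  define q n N M where "q = p ^ e" and "n = p * q" and "N = (n - 1) div 2" and "M = (p - 1) div 2"
  have q: "q > 0" "odd q" using p assms by (auto simp: q_def prime_gt_0_nat)
  have n: "n = 2 * N + 1" using q assms by (auto simp: n_def N_def elim!: oddE)
  have pM: "p = 2 * M + 1" using assms by (auto simp: M_def elim!: oddE)
  \<comment> \<open>With q = 2 h + 1 one gets N = M q + h and h < q. Hence the multiples of q in
    1..N are the q i with 1 <= i <= M.\<close>
  have NM: "M = N div q"
  proof -
    obtain h where h: "q = 2 * h + 1" using q by (auto elim!: oddE)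
    have "2 * N + 1 = (2 * M + 1) * q" using n by (simp add: n_def pM)
    then have "N = M * q + h" by (simp add: h algebra_simps)
    then show ?thesis using div_mult_self1 [of q h M] q h by (simp add: add.commute)
  qed
  define T where "T = (\<lambda>n i. (of_nat n / of_nat i) * (of_nat n / of_nat (n - 2 * i)) * u n i)"
  have D: "zcong p 4 (\<Prod>t=1..<n. dfac n t) (\<Prod>t=1..<p. dfac p t)"
    unfolding n_def mult.commute [of p q]
  proof (rule zcong_prod_multiples [OF q(1)])
    fix t assume t: "0 < t" "t < q * p"
    show "\<not> q dvd t \<Longrightarrow> zcong p 4 (dfac (q * p) t) 1" "dfac (q * p) t \<in> zloc p"
      using dfac_cong [of t e] dfac_zloc(1) [of t e] t by (auto simp: q_def mult.commute)
  next
    fix t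
    show "dfac (q * p) (q * t) = dfac p t" using q by (simp add: dfac_def)
  qed
  \<comment> \<open>Since q is odd and divides n, it divides n - 2 i only if it divides i. So both
    ratios in \<open>T n i\<close> carry a factor p^2.\<close>
  have Tz: "zcong p 4 (T n i) 0" if i: "0 < i" "i \<le> N" "\<not> q dvd i" for i
  proof -
    have nd: "\<not> q dvd n - 2 * i"
    proof
      assume "q dvd n - 2 * i"
      moreover have "q dvd n" by (simp add: n_def)
      ultimately have "q dvd n - (n - 2 * i)" by (rule dvd_diff_nat [rotated])
      moreover have "n - (n - 2 * i) = 2 * i" using that n by simp
      ultimately show False using that q by (simp add: coprime_dvd_mult_right_iff)
    qed
    have pos: "0 < n - 2 * i" using that n by simp
    have rat: "\<exists>z\<in>zloc p. of_nat n / of_nat t = of_nat p ^ 2 * z" if "0 < t" "\<not> q dvd t" for t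
      unfolding n_def q_def by (rule ratio_non_multiple) (use that in \<open>simp_all add: q_def\<close>)
    obtain z where z: "z \<in> zloc p" "of_nat n / of_nat i = of_nat p ^ 2 * z"
      using rat [OF i(1,3)] by (elim bexE)
    obtain z' where z': "z' \<in> zloc p" "of_nat n / of_nat (n - 2 * i) = of_nat p ^ 2 * z'"
      using rat [OF pos nd] by (elim bexE)
    have "u n i \<in> zloc p" using u_zloc [of i e] that n by (simp add: n_def q_def)
    then show ?thesis
      unfolding T_def zcong_def z z'
    proof (intro bexI [of _ "z * z' * u n i"])
      have "of_nat p ^ 4 = (of_nat p ^ 2 * of_nat p ^ 2 :: rat)" by (simp flip: power_add)
      then show "of_nat p ^ 2 * z * (of_nat p ^ 2 * z') * u n i - 0 = of_nat p ^ 4 * (z * z' * u n i)"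
        by (simp add: mult_ac)
      show "z * z' * u n i \<in> zloc p"
        using z z' \<open>u n i \<in> zloc p\<close> by (intro zloc_mult)
    qed
  qed
  \<comment> \<open>The two ratios agree exactly with those for p and together supply p^2, so a
    congruence of \<open>u\<close> modulo p^2 suffices.\<close>
  have Tm: "zcong p 4 (T n (q * i)) (T p i)" if "0 < i" "i \<le> M" for i
  proof -
    have i: "2 * i < p" using that pM by simp
    have "n - 2 * (q * i) = q * (p - 2 * i)" by (simp add: n_def algebra_simps diff_mult_distrib2)
    then have r: "of_nat n / of_nat (n - 2 * (q * i)) = (of_nat p / of_nat (p - 2 * i) :: rat)"
      "of_nat n / of_nat (q * i) = (of_nat p / of_nat i :: rat)"
      using q by (simp_all add: n_def)
    define z :: rat where "z = (1 / of_nat i) * (1 / of_nat (p - 2 * i))"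
    have "\<not> p dvd i" "\<not> p dvd p - 2 * i" using i that by (auto dest: dvd_imp_le)
    then have "z \<in> zloc p" unfolding z_def by (intro zloc_mult zloc_inverse_of_nat)
    moreover have "zcong p 2 (u n (q * i)) (u p i)"
      using u_cong [of i e] i that by (simp add: n_def q_def)
    ultimately have "zcong p (2 + 2) (of_nat p ^ 2 * z * u n (q * i)) (of_nat p ^ 2 * z * u p i)"
      by (intro zcong_mult_power)
    then show ?thesis unfolding T_def r by (simp add: z_def power2_eq_square)
  qed
  have "zcong p 4 (\<Sum>i=1..N. T n i) (\<Sum>i=1..M. T p i)"
    by (rule zcong_sum_multiples [where q = q]) (fact q Tz Tm NM)+
  then have "zcong p 4 (1 + (\<Sum>i=1..N. T n i)) (1 + (\<Sum>i=1..M. T p i))"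
    by (intro zcong_add) auto
  moreover have "(\<Prod>t=1..<p. dfac p t) \<in> zloc p"
    using dfac_zloc(1) [of _ 0] by (intro zloc_prod) auto
  \<comment> \<open>\<open>zcong_mult\<close> needs the second factor on the left and the first
    factor on the right to be p-integral.\<close>
  moreover have "T n i \<in> zloc p" if "0 < i" "i \<le> N" for i
  proof -
    have "0 < n - 2 * i" "n - 2 * i < n" "i < n" "2 * i \<le> n" using that n by auto
    then show ?thesis
      unfolding T_def using ratio_zloc [of _ e] u_zloc [of i e] \<open>0 < i\<close>
      by (intro zloc_mult) (simp_all only: n_def q_def)
  qed
  then have "1 + (\<Sum>i=1..N. T n i) \<in> zloc p" by (intro zloc_add zloc_sum) auto
  ultimately have "zcong p 4 (S n) (S p)"
    unfolding S_eq [OF n] S_eq [OF pM] T_def using D by (intro zcong_mult)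
  then show ?thesis by (simp add: n_def q_def)
qed

end

theorem theorem3p1:
  fixes p r :: nat
  assumes "prime p" and "odd p" and "r \<ge> 1"
  shows "rat_cong (S (p ^ r)) (S p) (int p) 4"
proof -
  obtain e where r: "r = Suc e" using assms(3) by (cases r) auto
  obtain z where z: "z \<in> zloc p" "S (p ^ r) - S p = of_nat p ^ 4 * z"
    using S_prime_power_cong [OF assms(1,2), of e] by (auto simp: zcong_def r)
  then have "(S (p ^ r) - S p) / of_int (int p) ^ 4 = z" using assms(1) by auto
  moreover from z(1) obtain x y :: int where "\<not> int p dvd y" "z = of_int x / of_int y"
    by (auto simp: zloc_def)
  moreover from this have "y \<noteq> 0" by auto
  ultimately show ?thesis unfolding rat_cong_def by blast
qed

end
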